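(* The safe zone satisfies $$\mathcal{D}=\{g\in\mathrm{SO}(3): Q(g)\ge 0\}\cap\{g\in\mathrm{SO}(3): U_1^2(g)\ge 4\}.$$
   Context: $\mathrm{SO}(3)$ is the group of rotations of $\mathbb{R}^3$ about the origin. Let $u_0=(0,0,1)$, $v_0=(1,0,0)$, $a_1=2u_0=(0,0,2)$, and let $\ell_0=\{2u_0+tv_0:t\in\mathbb{R}\}$. For $g\in\mathrm{SO}(3)$ the line $g\cdot\ell_0$ is the image $\{2gu_0+t\,gv_0:t\in\mathbb{R}\}$. The safe zone is $\mathcal{D}=\{g\in\mathrm{SO}(3):\mathrm{dist}(\ell_0,g\cdot\ell_0)\ge 2\}$, where $\mathrm{dist}$ is the Euclidean distance (infimum) between the two lines. For $g\in\mathrm{SO}(3)$ put $d_1=v_0$, $d_2=gv_0$, $a_2=2gu_0$, $w=a_2-a_1$, $n=d_1\times d_2$, $N_2=|n|^2$, and define $$\Gamma(w)=(w\cdot d_1)^2-2(w\cdot d_1)(w\cdot d_2)(d_1\cdot d_2)+(w\cdot d_2)^2,$$ $$U_1^2=U_1^2(g)=|w|^2-(w\cdot d_1)^2,\qquad Q=Q(g)=(|w|^2-4)N_2-\Gamma(w).$$ ($U_1\ge 0$ is the distance from the point $a_2$ to the line $\ell_0$.) *)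

theory Defs
  imports "HOL-Analysis.Analysis"
begin

definition SO3 :: "(real^3^3) set" where
  "SO3 = {g. rotation_matrix g}"

definition u0 :: "real^3" where "u0 = vector [0, 0, 1]"

definition v0 :: "real^3" where "v0 = vector [1, 0, 0]"

definition line0 :: "(real^3) set" where
  "line0 = {2 *\<^sub>R u0 + t *\<^sub>R v0 | t. t \<in> UNIV}"

definition act_line :: "real^3^3 \<Rightarrow> (real^3) set \<Rightarrow> (real^3) set" where
  "act_line g L = (\<lambda>x. g *v x) ` L"

definition safe_zone :: "(real^3^3) set" where
  "safe_zone = {g \<in> SO3. setdist line0 (act_line g line0) \<ge> 2}"

definition a1 :: "real^3" where "a1 = 2 *\<^sub>R u0"

definition a2 :: "real^3^3 \<Rightarrow> real^3" where "a2 g = 2 *\<^sub>R (g *v u0)"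

definition d1 :: "real^3" where "d1 = v0"

definition d2 :: "real^3^3 \<Rightarrow> real^3" where "d2 g = g *v v0"

definition w_vec :: "real^3^3 \<Rightarrow> real^3" where "w_vec g = a2 g - a1"

definition n_vec :: "real^3^3 \<Rightarrow> real^3" where "n_vec g = cross3 d1 (d2 g)"

definition N2 :: "real^3^3 \<Rightarrow> real" where "N2 g = (norm (n_vec g))\<^sup>2"

text \<open>The quadratic form \<open>\<Gamma>\<close> depends on \<open>g\<close> through \<open>d2 g\<close> as well as through its
  argument, so \<open>g\<close> is a separate parameter.\<close>

definition Gam :: "real^3^3 \<Rightarrow> real^3 \<Rightarrow> real" where
  "Gam g w = (w \<bullet> d1)\<^sup>2 - 2 * (w \<bullet> d1) * (w \<bullet> d2 g) * (d1 \<bullet> d2 g) + (w \<bullet> d2 g)\<^sup>2"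

definition U1sq :: "real^3^3 \<Rightarrow> real" where
  "U1sq g = (norm (w_vec g))\<^sup>2 - (w_vec g \<bullet> d1)\<^sup>2"

definition Qfun :: "real^3^3 \<Rightarrow> real" where
  "Qfun g = ((norm (w_vec g))\<^sup>2 - 4) * N2 g - Gam g (w_vec g)"

end

theory Submission
  imports Defs
begin

text \<open>For unit directions, minimising the squared distance between points of the two lines over
  the parameter of the first line leaves the quadratic polynomial
  \<open>U\<^sub>1\<^sup>2 + 2 \<beta> t + N\<^sub>2 t\<^sup>2\<close> in the parameter \<open>t\<close> of the second, where
  \<open>\<beta> = w \<bullet> d\<^sub>2 - (w \<bullet> d\<^sub>1) (d\<^sub>1 \<bullet> d\<^sub>2)\<close>, and \<open>Q = (U\<^sub>1\<^sup>2 - 4) N\<^sub>2 - \<beta>\<^sup>2\<close>. Thus the distance is at least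
  2 iff this polynomial minus 4 is nonnegative, and as \<open>N\<^sub>2 \<ge> 0\<close> this is the usual criterion
  for a binary quadratic form to be positive semidefinite.  The parallel case
  \<open>N\<^sub>2 = 0\<close> is included: there \<open>Q \<ge> 0\<close> just says \<open>\<beta> = 0\<close>.\<close>

lemma quadratic_nonneg_iff:
  fixes A B N :: real
  assumes "N \<ge> 0"
  shows "(\<forall>t. A + 2 * B * t + N * t\<^sup>2 \<ge> 0) \<longleftrightarrow> A \<ge> 0 \<and> A * N - B\<^sup>2 \<ge> 0"
proof (cases "N = 0")
  case True
  have "B = 0" if "\<forall>t. A + 2 * B * t \<ge> 0"
  proof (rule ccontr)
    assume "B \<noteq> 0"
    \<comment> \<open>At this \<open>t\<close> the affine function takes the value -1.\<close>
    with that[rule_format, of "(- A - 1) / (2 * B)"] show False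
      by simp
  qed
  with True show ?thesis
    by auto
next
  case False
  with assms have N: "N > 0" by simp
  have sq: "N * (A + 2 * B * t + N * t\<^sup>2) = (N * t + B)\<^sup>2 + (A * N - B\<^sup>2)" for t
    by (simp add: power2_eq_square algebra_simps)
  have iff: "A + 2 * B * t + N * t\<^sup>2 \<ge> 0 \<longleftrightarrow> (N * t + B)\<^sup>2 + (A * N - B\<^sup>2) \<ge> 0" for t
    using N by (simp add: sq[symmetric] zero_le_mult_iff)
  show ?thesis
  proof (intro iffI conjI allI)
    assume *: "\<forall>t. A + 2 * B * t + N * t\<^sup>2 \<ge> 0"
    show "A \<ge> 0"
      using *[rule_format, of 0] by simp
    show "A * N - B\<^sup>2 \<ge> 0"
      \<comment> \<open>The vertex of the parabola, where the completed square vanishes.\<close>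
      using *[rule_format, of "- B / N", unfolded iff] N by simp
  qed (simp add: iff)
qed

text \<open>Completing the square in \<open>s\<close>: the point of the line along \<open>d\<close>
  nearest to the one with parameter \<open>t\<close> on the other line has
  \<open>s = w \<bullet> d + t * (d \<bullet> e)\<close>, and the remaining summand is the minimum
  over \<open>s\<close>.\<close>

lemma lines_dist_sq:
  fixes w d e :: "'a::real_inner"
  assumes "norm d = 1" "norm e = 1"
  shows "(norm (w + t *\<^sub>R e - s *\<^sub>R d))\<^sup>2 =
    (s - (w \<bullet> d + t * (d \<bullet> e)))\<^sup>2 + ((norm w)\<^sup>2 - (w \<bullet> d)\<^sup>2 +
      2 * (w \<bullet> e - (w \<bullet> d) * (d \<bullet> e)) * t + (1 - (d \<bullet> e)\<^sup>2) * t\<^sup>2)"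
proof -
  have "d \<bullet> d = 1" "e \<bullet> e = 1"
    using assms by (simp_all add: dot_square_norm)
  then show ?thesis
    unfolding power2_norm_eq_inner
    by (simp add: inner_simps inner_commute power2_eq_square algebra_simps)
qed

lemma lines_setdist_ge_iff:
  fixes p q d e :: "'a::real_inner"
  assumes "norm d = 1" "norm e = 1" "r \<ge> 0"
  defines "w \<equiv> q - p"
  shows "setdist (range (\<lambda>s. p + s *\<^sub>R d)) (range (\<lambda>t. q + t *\<^sub>R e)) \<ge> r \<longleftrightarrow>
    (\<forall>t. (norm w)\<^sup>2 - (w \<bullet> d)\<^sup>2 - r\<^sup>2 +
      2 * (w \<bullet> e - (w \<bullet> d) * (d \<bullet> e)) * t + (1 - (d \<bullet> e)\<^sup>2) * t\<^sup>2 \<ge> 0)"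
    (is "?L \<longleftrightarrow> (\<forall>t. ?P t \<ge> 0)")
proof -
  have "dist (p + s *\<^sub>R d) (q + t *\<^sub>R e) \<ge> r \<longleftrightarrow>
      (s - (w \<bullet> d + t * (d \<bullet> e)))\<^sup>2 + ?P t \<ge> 0" for s t
  proof -
    have "dist (p + s *\<^sub>R d) (q + t *\<^sub>R e) = norm (w + t *\<^sub>R e - s *\<^sub>R d)"
      unfolding dist_norm w_def by (subst norm_minus_commute) (simp add: algebra_simps)
    moreover have "r \<le> norm x \<longleftrightarrow> r\<^sup>2 \<le> (norm x)\<^sup>2" for x :: 'a
      using \<open>r \<ge> 0\<close> by (simp add: power_mono_iff)
    ultimately show ?thesis
      by (simp add: lines_dist_sq[OF assms(1,2)]) linarith
  qed
  then have "?L \<longleftrightarrow> (\<forall>t s. (s - (w \<bullet> d + t * (d \<bullet> e)))\<^sup>2 + ?P t \<ge> 0)"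
    by (auto simp: le_setdist_iff)
  also have "\<dots> \<longleftrightarrow> (\<forall>t. ?P t \<ge> 0)"
  proof (intro iffI allI)
    fix t assume "\<forall>t s. (s - (w \<bullet> d + t * (d \<bullet> e)))\<^sup>2 + ?P t \<ge> 0"
    \<comment> \<open>The minimising \<open>s\<close> makes the square zero.\<close>
    from this[rule_format, of "w \<bullet> d + t * (d \<bullet> e)" t] show "?P t \<ge> 0"
      by simp
  next
    fix t s assume "\<forall>t. ?P t \<ge> 0"
    then show "(s - (w \<bullet> d + t * (d \<bullet> e)))\<^sup>2 + ?P t \<ge> 0"
      by (intro add_nonneg_nonneg[OF zero_le_power2]) (erule spec)
  qed
  finally show ?thesis .
qed

lemma line0_eq: "line0 = range (\<lambda>s. a1 + s *\<^sub>R d1)"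
  by (auto simp: line0_def a1_def d1_def)

lemma act_line0_eq: "act_line g line0 = range (\<lambda>t. a2 g + t *\<^sub>R d2 g)"
  by (simp add: line0_eq act_line_def image_image a1_def a2_def d1_def d2_def
      matrix_vector_right_distrib matrix_vector_mult_scaleR)

lemma norm_d1: "norm d1 = 1"
  by (simp add: d1_def v0_def norm_vec_def L2_set_def sum_3 vector_3)

lemma norm_d2:
  assumes "g \<in> SO3"
  shows "norm (d2 g) = 1"
proof -
  have "orthogonal_transformation ((*v) g)"
    using assms by (simp add: SO3_def rotation_matrix_def orthogonal_transformation_matrix)
  then show ?thesis
    using norm_d1 by (simp add: d2_def d1_def orthogonal_transformation)
qed

text \<open>Lagrange's identity for the cross product of two unit vectors.\<close>

lemma N2_eq:
  assumes "g \<in> SO3"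
  shows "N2 g = 1 - (d1 \<bullet> d2 g)\<^sup>2"
  using norm_cross[of d1 "d2 g"] by (simp add: N2_def n_vec_def norm_d1 norm_d2[OF assms])

theorem theorem5p5:
  shows "safe_zone = {g \<in> SO3. Qfun g \<ge> 0} \<inter> {g \<in> SO3. U1sq g \<ge> 4}"
proof -
  have "setdist line0 (act_line g line0) \<ge> 2 \<longleftrightarrow> Qfun g \<ge> 0 \<and> U1sq g \<ge> 4"
    if g: "g \<in> SO3" for g
  proof -
    define \<beta> where "\<beta> = w_vec g \<bullet> d2 g - (w_vec g \<bullet> d1) * (d1 \<bullet> d2 g)"
    have "setdist line0 (act_line g line0) \<ge> 2 \<longleftrightarrow>
        (\<forall>t. U1sq g - 4 + 2 * \<beta> * t + N2 g * t\<^sup>2 \<ge> 0)"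
      using lines_setdist_ge_iff[OF norm_d1 norm_d2[OF g], of 2 a1 "a2 g"]
      by (simp add: line0_eq[symmetric] act_line0_eq[symmetric]
          \<beta>_def U1sq_def w_vec_def N2_eq[OF g])
    also have "\<dots> \<longleftrightarrow> U1sq g - 4 \<ge> 0 \<and> (U1sq g - 4) * N2 g - \<beta>\<^sup>2 \<ge> 0"
      by (rule quadratic_nonneg_iff) (simp add: N2_def)
    \<comment> \<open>With \<open>a = w \<bullet> d1\<close>, \<open>b = w \<bullet> d2\<close> and
      \<open>c = d1 \<bullet> d2\<close>, this rests on \<open>a\<^sup>2 * (1 - c\<^sup>2) + (b - a
      * c)\<^sup>2 = a\<^sup>2 - 2 * a * b * c + b\<^sup>2\<close>, whose right-hand side is
      \<open>Gam\<close>.\<close>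
    also have "(U1sq g - 4) * N2 g - \<beta>\<^sup>2 = Qfun g"
      by (simp add: \<beta>_def U1sq_def Qfun_def Gam_def N2_eq[OF g] power2_eq_square algebra_simps)
    finally show ?thesis
      by auto
  qed
  then show ?thesis
    by (auto simp: safe_zone_def)
qed

end
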